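(* Let $\theta_0 \in (0,1)$, $\bar\theta_0 = 1-\theta_0$, $m_0 = \max\{\theta_0, \bar\theta_0\}$, let $n \ge 1$ be an integer, and let $\sigma_n = \sqrt{\theta_0\bar\theta_0 n}$. Let $k \in \{0,1,\dots,n\}$ and define $u$ by $k = \theta_0 n - u\sigma_n$. For real $x$ such that $\theta_x := (k - x\sigma_n)/n$ lies in $[0,1]$, let $$\mathrm{LR}_x = \left(\frac{\theta_x}{\theta_0}\right)^{k}\left(\frac{1-\theta_x}{\bar\theta_0}\right)^{n-k}.$$ Suppose $u > 0$, let $\varepsilon \in (0, 2/5)$, and suppose $m_0 u \le \varepsilon\sigma_n$. Then for all $x \in (-\tfrac32 u, \tfrac32 u)$, $$\mathrm{LR}_x \le \exp\left(\frac{u^2-x^2}{2} + |\bar\theta_0-\theta_0|\,\frac{25u^2\varepsilon}{12m_0} + \frac{1}{12}\,\frac{u^2\varepsilon^2}{1-\varepsilon}\right)$$ and $$\mathrm{LR}_x \ge \exp\left(\frac{u^2-x^2}{2} - |\bar\theta_0-\theta_0|\,\frac{25u^2\varepsilon}{12m_0} - \frac{297}{32}\,\frac{u^2\varepsilon^2}{2-5\varepsilon}\right).$$ Moreover, if in addition either $\theta_0 \le \bar\theta_0$ or $250\,(\theta_0-\bar\theta_0)\,\varepsilon \le 12 m_0$, then $\mathrm{LR}_x \le \exp(-u^2/2)$ for all $x \notin (-\tfrac32 u, \tfrac32 u)$ with $\theta_x \in [0,1]$.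
   Context: A coin with unknown success probability $\theta$ is tossed $n$ times, giving $k$ successes. $\mathrm{LR}_x$ is the likelihood ratio of the data for the hypothesis $H_x : \theta = (k-x\sigma_n)/n$ versus the hypothesis $H_0 : \theta = \theta_0$. The parameter $u$ measures how many standard deviations $\sigma_n$ the outcome $k$ lies below its mean $\theta_0 n$ under $H_0$. (Under the hypotheses of the theorem, $\theta_x \in (0,1)$ holds automatically for $x \in (-\tfrac32u,\tfrac32u)$.) *)

theory Defs
  imports Complex_Main
begin

definition sigma :: "real \<Rightarrow> nat \<Rightarrow> real" where
  "sigma \<theta>0 n = sqrt (\<theta>0 * (1 - \<theta>0) * real n)"

definition theta :: "real \<Rightarrow> nat \<Rightarrow> nat \<Rightarrow> real \<Rightarrow> real" where
  "theta \<theta>0 n k x = (real k - x * sigma \<theta>0 n) / real n"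

text \<open>
  Likelihood ratio of \<open>k\<close> successes in \<open>n\<close> tosses for the success probability
  \<open>theta \<theta>0 n k x\<close> versus \<open>\<theta>0\<close>. It is meaningful for \<open>k \<le> n\<close> and
  \<open>theta \<theta>0 n k x \<in> {0..1}\<close> only; the convention \<open>0 ^ 0 = 1\<close> applies.
\<close>

definition LR :: "real \<Rightarrow> nat \<Rightarrow> nat \<Rightarrow> real \<Rightarrow> real" where
  "LR \<theta>0 n k x =
     (theta \<theta>0 n k x / \<theta>0) ^ k * ((1 - theta \<theta>0 n k x) / (1 - \<theta>0)) ^ (n - k)"

end

theory Submission
  imports Defs
begin

text \<open>
  With \<open>y = u + x\<close>, \<open>a = (1 - \<theta>0) / \<sigma>\<close> and \<open>b = \<theta>0 / \<sigma>\<close>, the logarithm of the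
  likelihood ratio vanishes at \<open>y = 0\<close> and has derivative
  \<open>(u - y) / ((1 - a y) (1 + b y))\<close>. Expanding the denominator by partial fractions, the
  difference to the cubic Taylor polynomial has derivative \<open>(u - y) R y\<close> with
  \<open>0 \<le> R y \<le> M\<^sup>2 y\<^sup>2 / (1 - M \<bar>y\<bar>)\<close> for \<open>M = \<epsilon> / u\<close>. Integrating these
  bounds gives the constants \<open>1 / 12\<close> and \<open>297 / 32\<close>, and \<open>25 / 12\<close> is the maximum
  of the cubic term at the end \<open>y = 5 u / 2\<close>. Beyond the ends the
  likelihood ratio is monotone, so its values there suffice.
\<close>

section \<open>Logarithm of the likelihood ratio and its Taylor expansion\<close>

text \<open>The exponents \<open>k\<close> and \<open>n - k\<close> are expressed through
  \<open>a\<close>, \<open>b\<close> and \<open>u\<close> (see \<open>exponents_eq\<close>), so the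
  analysis involves real parameters only.\<close>

definition log_lr :: "real \<Rightarrow> real \<Rightarrow> real \<Rightarrow> real \<Rightarrow> real" where
  "log_lr a b u y = ((1 / a - u) * ln (1 - a * y) + (1 / b + u) * ln (1 + b * y)) / (a + b)"

text \<open>Antiderivative of \<open>(u - y) * (1 + (a - b) * y)\<close>, vanishing at 0.\<close>

definition cubic_lr :: "real \<Rightarrow> real \<Rightarrow> real \<Rightarrow> real \<Rightarrow> real" where
  "cubic_lr a b u y = u * y - y\<^sup>2 / 2 + (a - b) * (u * y\<^sup>2 / 2 - y ^ 3 / 3)"

definition rem_lr :: "real \<Rightarrow> real \<Rightarrow> real \<Rightarrow> real \<Rightarrow> real" where
  "rem_lr a b u y = log_lr a b u y - cubic_lr a b u y"

text \<open>\<open>y\<^sup>2\<close> times the mean of \<open>a\<^sup>2 / (1 - a * y)\<close> and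
  \<open>b\<^sup>2 / (1 + b * y)\<close> with weights proportional to \<open>a\<close> and
  \<open>b\<close>.\<close>

definition rem_factor :: "real \<Rightarrow> real \<Rightarrow> real \<Rightarrow> real" where
  "rem_factor a b y = y\<^sup>2 * ((a ^ 3 / (1 - a * y) + b ^ 3 / (1 + b * y)) / (a + b))"

lemma rem_lr_0 [simp]: "rem_lr a b u 0 = 0"
  by (simp add: rem_lr_def log_lr_def cubic_lr_def)

lemma DERIV_log_lr:
  assumes "a > 0" "b > 0" "1 - a * y > 0" "1 + b * y > 0"
  shows "(log_lr a b u has_real_derivative (u - y) / ((1 - a * y) * (1 + b * y))) (at y)"
proof -
  have "(log_lr a b u has_real_derivative
      ((1 / a - u) * (- a / (1 - a * y)) + (1 / b + u) * (b / (1 + b * y))) / (a + b)) (at y)"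
    unfolding log_lr_def [abs_def] using assms
    by (auto intro!: derivative_eq_intros simp: mult.commute)
  moreover have "((1 / a - u) * (- a / (1 - a * y)) + (1 / b + u) * (b / (1 + b * y))) / (a + b)
      = (u - y) / ((1 - a * y) * (1 + b * y))"
  proof -
    have "(1 / a - u) * (- a / (1 - a * y)) = (u * a - 1) / (1 - a * y)"
      using assms by (simp add: field_simps)
    moreover have "(1 / b + u) * (b / (1 + b * y)) = (1 + u * b) / (1 + b * y)"
    proof -
      have "(1 / b + u) * b = 1 + u * b"
        using assms by (simp add: field_simps)
      then show ?thesis
        by simp
    qed
    moreover have "(u * a - 1) / (1 - a * y) + (1 + u * b) / (1 + b * y)
        = ((u * a - 1) * (1 + b * y) + (1 + u * b) * (1 - a * y)) / ((1 - a * y) * (1 + b * y))"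
      using assms by (subst add_frac_eq) auto
    moreover have "(u * a - 1) * (1 + b * y) + (1 + u * b) * (1 - a * y) = (a + b) * (u - y)"
      by algebra
    ultimately show ?thesis
      using assms by simp
  qed
  ultimately show ?thesis
    by simp
qed

text \<open>The sum \<open>a / (1 - a * y) + b / (1 + b * y)\<close> is \<open>a + b\<close> times
  the left-hand side. Both geometric series are cut after the linear term with exact remainder, and
  \<open>a\<^sup>2 - b\<^sup>2 = (a + b) * (a - b)\<close> lets \<open>a + b\<close> cancel.\<close>

lemma inverse_denominator_expansion:
  fixes a b y :: real
  assumes "a > 0" "b > 0" "1 - a * y > 0" "1 + b * y > 0"
  shows "1 / ((1 - a * y) * (1 + b * y)) = 1 + (a - b) * y + rem_factor a b y"
proof -
  have "a / (1 - a * y) = a + a\<^sup>2 * y + y\<^sup>2 * (a ^ 3 / (1 - a * y))"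
    using assms by (simp add: field_simps power2_eq_square power3_eq_cube)
  moreover have "b / (1 + b * y) = b - b\<^sup>2 * y + y\<^sup>2 * (b ^ 3 / (1 + b * y))"
    using assms by (simp add: field_simps power2_eq_square power3_eq_cube)
  ultimately have "a / (1 - a * y) + b / (1 + b * y)
      = (a + b) * (1 + (a - b) * y) + y\<^sup>2 * (a ^ 3 / (1 - a * y) + b ^ 3 / (1 + b * y))"
    by (simp add: algebra_simps power2_eq_square)
  moreover have "a / (1 - a * y) + b / (1 + b * y) = (a + b) / ((1 - a * y) * (1 + b * y))"
    using assms by (simp add: add_frac_eq algebra_simps)
  ultimately have "1 / ((1 - a * y) * (1 + b * y)) = ((a + b) * (1 + (a - b) * y)
      + y\<^sup>2 * (a ^ 3 / (1 - a * y) + b ^ 3 / (1 + b * y))) / (a + b)"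
    using assms
    by (metis add_pos_pos divide_divide_eq_left' div_by_1 divide_self less_irrefl mult.commute)
  then show ?thesis
    using assms by (simp add: rem_factor_def add_divide_distrib [of "(a + b) * _"])
qed

lemma DERIV_rem_lr:
  assumes "a > 0" "b > 0" "1 - a * y > 0" "1 + b * y > 0"
  shows "(rem_lr a b u has_real_derivative (u - y) * rem_factor a b y) (at y)"
proof -
  have "(cubic_lr a b u has_real_derivative (u - y) * (1 + (a - b) * y)) (at y)"
    unfolding cubic_lr_def [abs_def]
    by (auto intro!: derivative_eq_intros simp: field_simps power2_eq_square)
  from DERIV_diff [OF DERIV_log_lr [OF assms] this] have
    "(rem_lr a b u has_real_derivative
        (u - y) * (1 / ((1 - a * y) * (1 + b * y))) - (u - y) * (1 + (a - b) * y)) (at y)"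
    by (simp add: rem_lr_def [abs_def])
  then show ?thesis
    unfolding inverse_denominator_expansion [OF assms] by (simp add: algebra_simps)
qed

section \<open>Sign and size of the remainder factor\<close>

lemma rem_factor_nonneg:
  assumes "a > 0" "b > 0" "1 - a * y > 0" "1 + b * y > 0"
  shows "rem_factor a b y \<ge> 0"
proof -
  have "a ^ 3 / (1 - a * y) \<ge> 0" "b ^ 3 / (1 + b * y) \<ge> 0"
    using assms by (auto intro: divide_nonneg_pos)
  then show ?thesis
    using assms by (simp add: rem_factor_def)
qed

lemma mult_le_of_abs_le:
  fixes a y :: real
  assumes "0 < a" "a \<le> M" "\<bar>y\<bar> \<le> t"
  shows "\<bar>a * y\<bar> \<le> M * t"
  using assms by (simp add: abs_mult mult_mono)

text \<open>Both terms of the weighted mean obey the same bound. Freezing the denominator at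
  \<open>t\<close> leaves a constant multiple of \<open>y\<^sup>2\<close>, which can be integrated
  explicitly.\<close>

lemma rem_factor_le:
  assumes "a > 0" "b > 0" "a \<le> M" "b \<le> M" "\<bar>y\<bar> \<le> t" "M * t < 1"
  shows "rem_factor a b y \<le> M\<^sup>2 / (1 - M * t) * y\<^sup>2"
proof -
  have ay: "\<bar>a * y\<bar> \<le> M * t" and byt: "\<bar>b * y\<bar> \<le> M * t"
    using assms by (auto intro: mult_le_of_abs_le)
  \<comment> \<open>One factor \<open>c\<close> stays outside, so that the bounds for
    \<open>a\<close> and \<open>b\<close> add up to a multiple of \<open>a + b\<close>.\<close>
  have *: "c ^ 3 / d \<le> c * (M\<^sup>2 / (1 - M * t))" if "c > 0" "c \<le> M" "1 - M * t \<le> d" for c d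
  proof -
    have "c\<^sup>2 / d \<le> M\<^sup>2 / (1 - M * t)"
      using that assms(6) by (intro frac_le power_mono) auto
    then have "c * (c\<^sup>2 / d) \<le> c * (M\<^sup>2 / (1 - M * t))"
      using that by (intro mult_left_mono) auto
    then show ?thesis
      by (simp add: power2_eq_square power3_eq_cube)
  qed
  have "a ^ 3 / (1 - a * y) + b ^ 3 / (1 + b * y) \<le> (a + b) * (M\<^sup>2 / (1 - M * t))"
    using * [of a "1 - a * y"] * [of b "1 + b * y"] assms ay byt
    unfolding distrib_right by linarith
  then have "(a ^ 3 / (1 - a * y) + b ^ 3 / (1 + b * y)) / (a + b) \<le> M\<^sup>2 / (1 - M * t)"
    using assms by (simp add: pos_divide_le_eq mult.commute)
  then have "y\<^sup>2 * ((a ^ 3 / (1 - a * y) + b ^ 3 / (1 + b * y)) / (a + b))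
      \<le> y\<^sup>2 * (M\<^sup>2 / (1 - M * t))"
    by (intro mult_left_mono) auto
  then show ?thesis
    by (simp add: rem_factor_def mult.commute)
qed

section \<open>Comparison polynomial and monotonicity\<close>

text \<open>The subtracted polynomial integrates \<open>C * (u - y) * y\<^sup>2\<close>. Where
  \<open>rem_factor a b y \<le> C * y\<^sup>2\<close>, the sign of \<open>u - y\<close> decides
  whether the difference falls or rises.\<close>

lemma DERIV_rem_lr_diff:
  assumes "a > 0" "b > 0" "1 - a * y > 0" "1 + b * y > 0"
  shows "((\<lambda>y. rem_lr a b u y - C * (u * y ^ 3 / 3 - y ^ 4 / 4)) has_real_derivative
      (u - y) * (rem_factor a b y - C * y\<^sup>2)) (at y)"
proof -
  have "((\<lambda>y. C * (u * y ^ 3 / 3 - y ^ 4 / 4)) has_real_derivative C * ((u - y) * y\<^sup>2)) (at y)"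
    by (auto intro!: derivative_eq_intros simp: algebra_simps power2_eq_square power3_eq_cube)
  from DERIV_diff [OF DERIV_rem_lr [OF assms] this] show ?thesis
    by (simp add: algebra_simps)
qed

text \<open>The factor with \<open>a\<close> is smallest at the right end, the one with
  \<open>b\<close> at the left end; hence one positivity assumption per end.\<close>

lemma domain_convex:
  fixes a b :: real
  assumes "a > 0" "b > 0" "1 + b * y > 0" "1 - a * z > 0" "y \<le> x" "x \<le> z"
  shows "1 - a * x > 0" "1 + b * x > 0"
  using mult_left_mono [OF assms(5), of b] mult_left_mono [OF assms(6), of a] assms by linarith+

text \<open>The derivative has the sign of \<open>u - x\<close>. With
  \<open>rem_lr_antimono\<close>, the remainder is therefore largest at \<open>u\<close>.\<close>

lemma rem_lr_mono:
  assumes "a > 0" "b > 0" "1 + b * y > 0" "1 - a * z > 0" "y \<le> z" "z \<le> u"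
  shows "rem_lr a b u y \<le> rem_lr a b u z"
proof (rule DERIV_nonneg_imp_nondecreasing [OF \<open>y \<le> z\<close>])
  fix x assume x: "y \<le> x" "x \<le> z"
  note d = domain_convex [OF assms(1-4) x]
  show "\<exists>D. (rem_lr a b u has_real_derivative D) (at x) \<and> 0 \<le> D"
    using DERIV_rem_lr [OF assms(1,2) d] rem_factor_nonneg [OF assms(1,2) d] x assms(6)
    by (intro exI [of _ "(u - x) * rem_factor a b x"] conjI
        mult_nonneg_nonneg) auto
qed

lemma rem_lr_antimono:
  assumes "a > 0" "b > 0" "1 + b * y > 0" "1 - a * z > 0" "y \<le> z" "u \<le> y"
  shows "rem_lr a b u z \<le> rem_lr a b u y"
proof (rule DERIV_nonpos_imp_nonincreasing [OF \<open>y \<le> z\<close>])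
  fix x assume x: "y \<le> x" "x \<le> z"
  note d = domain_convex [OF assms(1-4) x]
  show "\<exists>D. (rem_lr a b u has_real_derivative D) (at x) \<and> D \<le> 0"
    using DERIV_rem_lr [OF assms(1,2) d] rem_factor_nonneg [OF assms(1,2) d] x assms(6)
    by (intro exI [of _ "(u - x) * rem_factor a b x"] conjI
        mult_nonpos_nonneg) auto
qed

text \<open>With \<open>log_lr_antimono\<close>, this carries bounds at the ends
  \<open>- u / 2\<close> and \<open>5 * u / 2\<close> outward.\<close>

lemma log_lr_mono:
  assumes "a > 0" "b > 0" "1 + b * y > 0" "1 - a * z > 0" "y \<le> z" "z \<le> u"
  shows "log_lr a b u y \<le> log_lr a b u z"
proof (rule DERIV_nonneg_imp_nondecreasing [OF \<open>y \<le> z\<close>])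
  fix x assume x: "y \<le> x" "x \<le> z"
  note d = domain_convex [OF assms(1-4) x]
  show "\<exists>D. (log_lr a b u has_real_derivative D) (at x) \<and> 0 \<le> D"
    using DERIV_log_lr [OF assms(1,2) d] d x assms(6)
    by (intro exI [of _ "(u - x) / ((1 - a * x) * (1 + b * x))"] conjI
        divide_nonneg_nonneg mult_nonneg_nonneg) auto
qed

lemma log_lr_antimono:
  assumes "a > 0" "b > 0" "1 + b * y > 0" "1 - a * z > 0" "y \<le> z" "u \<le> y"
  shows "log_lr a b u z \<le> log_lr a b u y"
proof (rule DERIV_nonpos_imp_nonincreasing [OF \<open>y \<le> z\<close>])
  fix x assume x: "y \<le> x" "x \<le> z"
  note d = domain_convex [OF assms(1-4) x]
  show "\<exists>D. (log_lr a b u has_real_derivative D) (at x) \<and> D \<le> 0"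
    using DERIV_log_lr [OF assms(1,2) d] d x assms(6)
    by (intro exI [of _ "(u - x) / ((1 - a * x) * (1 + b * x))"] conjI
        divide_nonpos_nonneg mult_nonneg_nonneg) auto
qed

section \<open>Upper and lower bounds for the remainder\<close>

text \<open>It suffices to bound the maximum, at \<open>u\<close>. Comparison on
  \<open>[0, u]\<close> gives it, since \<open>(u - y) * y\<^sup>2\<close> has integral
  \<open>u ^ 4 / 12\<close> there.\<close>

lemma rem_lr_le:
  assumes "a > 0" "b > 0" "a \<le> M" "b \<le> M" "u > 0" "M * u < 1"
    and "1 - a * y > 0" "1 + b * y > 0"
  shows "rem_lr a b u y \<le> M\<^sup>2 * u ^ 4 / (12 * (1 - M * u))"
proof -
  define C where "C = M\<^sup>2 / (1 - M * u)"
  have C: "C \<ge> 0"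
    using assms(6) by (simp add: C_def)
  have dom: "1 - a * x > 0" "1 + b * x > 0" if "0 \<le> x" "x \<le> u" for x
    using that assms mult_le_of_abs_le [of a M x u] mult_nonneg_nonneg [of b x]
    by (auto intro: add_pos_nonneg)
  have "rem_lr a b u u - C * (u * u ^ 3 / 3 - u ^ 4 / 4)
      \<le> rem_lr a b u 0 - C * (u * 0 ^ 3 / 3 - 0 ^ 4 / 4)"
  proof (rule DERIV_nonpos_imp_nonincreasing [of 0 u])
    fix x assume x: "0 \<le> x" "x \<le> u"
    have "rem_factor a b x \<le> C * x\<^sup>2"
      unfolding C_def using x assms by (intro rem_factor_le) auto
    then show "\<exists>D. ((\<lambda>y. rem_lr a b u y - C * (u * y ^ 3 / 3 - y ^ 4 / 4))
        has_real_derivative D) (at x) \<and> D \<le> 0"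
      using DERIV_rem_lr_diff [OF assms(1,2) dom [OF x]] x
      by (intro exI [of _ "(u - x) * (rem_factor a b x - C * x\<^sup>2)"] conjI
          mult_nonneg_nonpos) auto
  qed (use assms in auto)
  moreover have "u * u ^ 3 / 3 - u ^ 4 / 4 = u ^ 4 / 12"
    by (simp add: power_numeral_reduce)
  ultimately have "rem_lr a b u u \<le> C * (u ^ 4 / 12)"
    by simp
  also have "C * (u ^ 4 / 12) = M\<^sup>2 * u ^ 4 / (12 * (1 - M * u))"
    by (simp add: C_def)
  finally have le: "rem_lr a b u u \<le> M\<^sup>2 * u ^ 4 / (12 * (1 - M * u))" .
  have "rem_lr a b u y \<le> rem_lr a b u u"
    using rem_lr_mono [of a b y u u] rem_lr_antimono [of a b u y u] dom [of u] assms by linarith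
  with le show ?thesis
    by simp
qed

text \<open>The remainder vanishes at 0 and falls away from \<open>u\<close> on both sides. So it is
  nonnegative on \<open>[0, u]\<close>, and the comparison polynomial limits the fall to the left of
  0 and to the right of \<open>u\<close>.\<close>

lemma rem_lr_ge:
  assumes "a > 0" "b > 0" "a \<le> M" "b \<le> M" "u > 0" "5 * (M * u) < 2"
    and y: "- u / 2 \<le> y" "y \<le> 5 * u / 2"
  shows "rem_lr a b u y \<ge> - (297 / 32 * (M\<^sup>2 * u ^ 4 / (2 - 5 * (M * u))))"
proof -
  let ?P = "\<lambda>y. u * y ^ 3 / 3 - y ^ 4 / 4"
  define C where "C = M\<^sup>2 / (1 - M * (5 * u / 2))"
  have C: "C \<ge> 0"
    using assms(6) by (simp add: C_def)
  have dom: "1 - a * x > 0" "1 + b * x > 0" if "- u / 2 \<le> x" "x \<le> 5 * u / 2" for x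
  proof -
    have "\<bar>x\<bar> \<le> 5 * u / 2"
      using that assms(5) by auto
    then show "1 - a * x > 0" "1 + b * x > 0"
      using assms mult_le_of_abs_le [of a M x "5 * u / 2"] mult_le_of_abs_le [of b M x "5 * u / 2"]
      by auto
  qed
  have R: "rem_factor a b x \<le> C * x\<^sup>2" if "- u / 2 \<le> x" "x \<le> 5 * u / 2" for x
    unfolding C_def using that assms by (intro rem_factor_le) auto
  have bound: "C * (297 / 64 * u ^ 4) = 297 / 32 * (M\<^sup>2 * u ^ 4 / (2 - 5 * (M * u)))"
    using assms(6) by (simp add: C_def field_simps)
  consider "y \<le> 0" | "0 \<le> y" "y \<le> u" | "u \<le> y"
    by linarith
  then have "rem_lr a b u y \<ge> - (C * (297 / 64 * u ^ 4))"
  proof cases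
    case 1
    have "rem_lr a b u 0 - C * ?P 0 \<le> rem_lr a b u y - C * ?P y"
    proof (rule DERIV_nonpos_imp_nonincreasing [OF 1])
      fix x assume x: "y \<le> x" "x \<le> 0"
      then show "\<exists>D. ((\<lambda>y. rem_lr a b u y - C * ?P y) has_real_derivative D) (at x) \<and> D \<le> 0"
        using DERIV_rem_lr_diff [OF assms(1,2) dom, of x] R [of x] y assms(5)
        by (intro exI [of _ "(u - x) * (rem_factor a b x - C * x\<^sup>2)"] conjI
            mult_nonneg_nonpos) auto
    qed
    \<comment> \<open>The estimate \<open>- y \<le> u\<close> already gives
      \<open>7 / 12 * u ^ 4\<close>, well below the constant dictated by the right end.\<close>
    moreover have "- ?P y \<le> 297 / 64 * u ^ 4"
    proof -
      have "(- y) ^ 3 \<le> u ^ 3" "(- y) ^ 4 \<le> u ^ 4"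
        using 1 y assms(5) by (intro power_mono; simp)+
      then have "u * (- y) ^ 3 \<le> u ^ 4" "y ^ 4 \<le> u ^ 4"
        using assms(5) mult_left_mono [of "(- y) ^ 3" "u ^ 3" u]
        by (simp_all add: power_numeral_reduce)
      moreover have "- ?P y = u * (- y) ^ 3 / 3 + y ^ 4 / 4"
        by (simp add: power_numeral_reduce)
      moreover have "0 \<le> u ^ 4"
        by simp
      ultimately show ?thesis
        by linarith
    qed
    then have "C * (- ?P y) \<le> C * (297 / 64 * u ^ 4)"
      using C by (intro mult_left_mono)
    then have "- (C * (297 / 64 * u ^ 4)) \<le> C * ?P y"
      unfolding mult_minus_right by linarith
    ultimately show ?thesis
      by simp
  next
    case 2
    then have "0 \<le> rem_lr a b u y"
      using rem_lr_mono [of a b 0 y u] dom [of y] assms by auto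
    moreover have "0 \<le> C * (297 / 64 * u ^ 4)"
      using C by simp
    ultimately show ?thesis
      by linarith
  next
    case 3
    have "rem_lr a b u u - C * ?P u \<le> rem_lr a b u (5 * u / 2) - C * ?P (5 * u / 2)"
    proof (rule DERIV_nonneg_imp_nondecreasing [of u "5 * u / 2"])
      fix x assume x: "u \<le> x" "x \<le> 5 * u / 2"
      then show "\<exists>D. ((\<lambda>y. rem_lr a b u y - C * ?P y) has_real_derivative D) (at x) \<and> 0 \<le> D"
        using DERIV_rem_lr_diff [OF assms(1,2) dom, of x] R [of x] assms(5)
        by (intro exI [of _ "(u - x) * (rem_factor a b x - C * x\<^sup>2)"] conjI
            mult_nonpos_nonpos) auto
    qed (use assms in auto)
    moreover have "0 \<le> rem_lr a b u u"
      using rem_lr_mono [of a b 0 u u] dom [of u] assms by auto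
    moreover have "rem_lr a b u (5 * u / 2) \<le> rem_lr a b u y"
      using rem_lr_antimono [of a b y "5 * u / 2" u] dom [of y] dom [of "5 * u / 2"] 3 y assms
      by auto
    \<comment> \<open>In units of \<open>u ^ 4\<close>, this is
      \<open>125 / 24 - 625 / 64 - 1 / 12 = - 297 / 64\<close>; clearing the fraction in the
      denominator of \<open>C\<close> doubles it to \<open>297 / 32\<close>.\<close>
    moreover have "C * ?P (5 * u / 2) - C * ?P u = - (C * (297 / 64 * u ^ 4))"
      by (simp add: field_simps power_numeral_reduce)
    ultimately show ?thesis
      by linarith
  qed
  then show ?thesis
    unfolding bound .
qed

text \<open>The minimum \<open>- 25 / 12 * u ^ 3\<close> is attained at \<open>5 * u / 2\<close>,
  the maximum \<open>u ^ 3 / 6\<close> at \<open>u\<close> and at \<open>- u / 2\<close>. Factoring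
  out these zeros leaves expressions of evident sign.\<close>

lemma cubic_term_abs_le:
  fixes u y :: real
  assumes "u > 0" "- u / 2 \<le> y" "y \<le> 5 * u / 2"
  shows "\<bar>u * y\<^sup>2 / 2 - y ^ 3 / 3\<bar> \<le> 25 / 12 * u ^ 3"
proof -
  have "25 / 12 * u ^ 3 + (u * y\<^sup>2 / 2 - y ^ 3 / 3)
      = (5 * u / 2 - y) * (4 * y\<^sup>2 + 4 * u * y + 10 * u\<^sup>2) / 12"
    by (simp add: field_simps power2_eq_square power3_eq_cube)
  moreover have "4 * y\<^sup>2 + 4 * u * y + 10 * u\<^sup>2 = (2 * y + u)\<^sup>2 + 9 * u\<^sup>2"
    by (simp add: field_simps power2_eq_square)
  ultimately have "0 \<le> 25 / 12 * u ^ 3 + (u * y\<^sup>2 / 2 - y ^ 3 / 3)"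
    using assms by (simp only:) simp
  moreover have "u ^ 3 / 6 - (u * y\<^sup>2 / 2 - y ^ 3 / 3) = (y - u)\<^sup>2 * (2 * y + u) / 6"
    by (simp add: field_simps power2_eq_square power3_eq_cube)
  then have "0 \<le> u ^ 3 / 6 - (u * y\<^sup>2 / 2 - y ^ 3 / 3)"
    using assms by (simp only:) simp
  moreover have "u ^ 3 \<ge> 0"
    using assms by simp
  ultimately show ?thesis
    by linarith
qed

section \<open>Translation of the coin-tossing data into \<open>a\<close>, \<open>b\<close>,
  \<open>u\<close> and \<open>y\<close>\<close>

lemma sigma_pos:
  assumes "0 < \<theta>0" "\<theta>0 < 1" "n \<ge> 1"
  shows "sigma \<theta>0 n > 0"
  using assms by (simp add: sigma_def)

lemma theta_ratios:
  fixes \<theta>0 u x :: real and n k :: nat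
  defines "s \<equiv> sigma \<theta>0 n"
  assumes "0 < \<theta>0" "\<theta>0 < 1" "n \<ge> 1" and k: "real k = \<theta>0 * real n - u * s"
  shows "theta \<theta>0 n k x / \<theta>0 = 1 - (1 - \<theta>0) / s * (u + x)"
    and "(1 - theta \<theta>0 n k x) / (1 - \<theta>0) = 1 + \<theta>0 / s * (u + x)"
proof -
  have s: "s > 0" "s * s = \<theta>0 * (1 - \<theta>0) * real n"
    using sigma_pos [OF assms(2-4)] assms(2-4) by (simp_all add: s_def sigma_def)
  then have n: "real n = s * s / (\<theta>0 * (1 - \<theta>0))"
    using assms(2,3) by (simp add: field_simps)
  have "theta \<theta>0 n k x = \<theta>0 - (u + x) * s / real n"
    using assms(4) k by (simp add: theta_def s_def [symmetric] field_simps)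
  also have "\<dots> = \<theta>0 - (u + x) * (\<theta>0 * (1 - \<theta>0)) / s"
    using s assms(2,3) by (simp add: n)
  finally have "theta \<theta>0 n k x = \<theta>0 - (u + x) * (\<theta>0 * (1 - \<theta>0)) / s" .
  then show "theta \<theta>0 n k x / \<theta>0 = 1 - (1 - \<theta>0) / s * (u + x)"
    and "(1 - theta \<theta>0 n k x) / (1 - \<theta>0) = 1 + \<theta>0 / s * (u + x)"
    using s assms(2,3) by (simp_all add: field_simps)
qed

text \<open>Here \<open>a + b = 1 / s\<close>, while \<open>\<theta>0 * n = s / a\<close> and
  \<open>(1 - \<theta>0) * n = s / b\<close> because \<open>s\<^sup>2\<close> is the
  variance.\<close>

lemma exponents_eq:
  fixes \<theta>0 u :: real and n k :: nat
  defines "s \<equiv> sigma \<theta>0 n"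
  defines "a \<equiv> (1 - \<theta>0) / s" and "b \<equiv> \<theta>0 / s"
  assumes "0 < \<theta>0" "\<theta>0 < 1" "n \<ge> 1" "k \<le> n" and k: "real k = \<theta>0 * real n - u * s"
  shows "real k = (1 / a - u) / (a + b)" "real (n - k) = (1 / b + u) / (a + b)"
proof -
  have s: "s > 0" "s * s = \<theta>0 * (1 - \<theta>0) * real n"
    using sigma_pos [OF assms(4-6)] assms(4-6) by (simp_all add: s_def sigma_def)
  have ab: "a + b = 1 / s"
    using s by (simp add: a_def b_def field_simps)
  have "\<theta>0 * real n = s * s / (1 - \<theta>0)" "(1 - \<theta>0) * real n = s * s / \<theta>0"
    using s assms(4,5) by (simp_all add: field_simps)
  then show "real k = (1 / a - u) / (a + b)" "real (n - k) = (1 / b + u) / (a + b)"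
    using s k \<open>k \<le> n\<close> unfolding ab
    by (simp_all add: a_def b_def of_nat_diff left_diff_distrib distrib_right)
qed

text \<open>Strict positivity makes the logarithms meaningful; success probabilities 0 and 1 are
  treated separately in the final proof.\<close>

lemma LR_eq_exp:
  fixes \<theta>0 u x :: real and n k :: nat
  defines "s \<equiv> sigma \<theta>0 n"
  defines "a \<equiv> (1 - \<theta>0) / s" and "b \<equiv> \<theta>0 / s"
  assumes "0 < \<theta>0" "\<theta>0 < 1" "n \<ge> 1" "k \<le> n" "real k = \<theta>0 * real n - u * s"
    and pos: "1 - a * (u + x) > 0" "1 + b * (u + x) > 0"
  shows "LR \<theta>0 n k x = exp (log_lr a b u (u + x))"
proof -
  note ex = exponents_eq [OF assms(4-8) [unfolded s_def], folded s_def, folded a_def b_def]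
  have "exp (log_lr a b u (u + x))
      = exp (real k * ln (1 - a * (u + x)) + real (n - k) * ln (1 + b * (u + x)))"
    unfolding ex log_lr_def by (simp add: add_divide_distrib [of "_ * ln _"])
  also have "\<dots> = (1 - a * (u + x)) ^ k * (1 + b * (u + x)) ^ (n - k)"
    using pos by (simp add: exp_add exp_of_nat_mult)
  also have "\<dots> = LR \<theta>0 n k x"
    using theta_ratios [OF assms(4-6) assms(8) [unfolded s_def], of x]
    by (simp add: LR_def a_def b_def s_def)
  finally show ?thesis ..
qed

section \<open>From the logarithmic estimates to the likelihood ratio\<close>

theorem theorem2:
  fixes \<theta>0 \<theta>0' m0 u \<epsilon> :: real and n k :: nat
  assumes theta0: "0 < \<theta>0" "\<theta>0 < 1"
    and theta0': "\<theta>0' = 1 - \<theta>0"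
    and m0: "m0 = max \<theta>0 \<theta>0'"
    and n: "n \<ge> 1"
    and k: "k \<le> n"
    and u: "real k = \<theta>0 * real n - u * sigma \<theta>0 n"
    and u_pos: "u > 0"
    and eps: "0 < \<epsilon>" "\<epsilon> < 2 / 5"
    and m0_u: "m0 * u \<le> \<epsilon> * sigma \<theta>0 n"
  shows "(\<forall>x::real. - (3 / 2) * u < x \<and> x < 3 / 2 * u \<longrightarrow>
            LR \<theta>0 n k x \<le>
              exp ((u\<^sup>2 - x\<^sup>2) / 2 + \<bar>\<theta>0' - \<theta>0\<bar> * (25 * u\<^sup>2 * \<epsilon> / (12 * m0))
                   + 1 / 12 * (u\<^sup>2 * \<epsilon>\<^sup>2 / (1 - \<epsilon>))) \<and>
            LR \<theta>0 n k x \<ge>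
              exp ((u\<^sup>2 - x\<^sup>2) / 2 - \<bar>\<theta>0' - \<theta>0\<bar> * (25 * u\<^sup>2 * \<epsilon> / (12 * m0))
                   - 297 / 32 * (u\<^sup>2 * \<epsilon>\<^sup>2 / (2 - 5 * \<epsilon>)))) \<and>
         (\<theta>0 \<le> \<theta>0' \<or> 250 * (\<theta>0 - \<theta>0') * \<epsilon> \<le> 12 * m0 \<longrightarrow>
            (\<forall>x::real. \<not> (- (3 / 2) * u < x \<and> x < 3 / 2 * u) \<and>
                 0 \<le> theta \<theta>0 n k x \<and> theta \<theta>0 n k x \<le> 1 \<longrightarrow>
               LR \<theta>0 n k x \<le> exp (- u\<^sup>2 / 2)))"
proof -
  define s where "s = sigma \<theta>0 n"
  define a where "a = \<theta>0' / s"
  define b where "b = \<theta>0 / s"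
  define M where "M = \<epsilon> / u"
  define c where "c = 25 * u\<^sup>2 * \<epsilon> / (12 * m0)"
  have s: "s > 0"
    using sigma_pos [OF theta0 n] by (simp add: s_def)
  have m0_pos: "m0 > 0"
    using theta0 by (simp add: m0)
  have pos: "a > 0" "b > 0"
    using s theta0 by (simp_all add: a_def b_def theta0')
  \<comment> \<open>Since \<open>m0\<close> is the larger of \<open>\<theta>0\<close> and
    \<open>\<theta>0'\<close>, this bounds both \<open>a\<close> and \<open>b\<close> by
    \<open>M\<close>.\<close>
  have m0M: "m0 / s \<le> M"
    using m0_u s u_pos by (simp add: M_def s_def [symmetric] field_simps)
  have le: "a \<le> M" "b \<le> M"
    by (rule order_trans [OF _ m0M]; use s in \<open>simp add: a_def b_def m0 divide_right_mono\<close>)+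
  have Mu: "M * u = \<epsilon>" and Mu4: "M\<^sup>2 * u ^ 4 = u\<^sup>2 * \<epsilon>\<^sup>2"
    using u_pos by (simp_all add: M_def power2_eq_square power_numeral_reduce)
  have Mu1: "M * u < 1" "5 * (M * u) < 2"
    using eps by (simp_all add: Mu)
  have au: "a * u \<le> \<epsilon>" "b * u \<le> \<epsilon>"
    using mult_right_mono [OF le(1), of u] mult_right_mono [OF le(2), of u] u_pos
    by (simp_all add: Mu)
  have LR_eq: "LR \<theta>0 n k x = exp (log_lr a b u (u + x))"
    if "1 - a * (u + x) > 0" "1 + b * (u + x) > 0" for x
    using LR_eq_exp [OF theta0 n k u, of x] that by (simp add: a_def b_def s_def theta0')
  \<comment> \<open>At the right end \<open>a * y \<le> 5 / 2 * \<epsilon>\<close>, which is below 1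
    exactly because \<open>\<epsilon> < 2 / 5\<close>.\<close>
  have dom: "1 - a * y > 0" "1 + b * y > 0" if "- u / 2 \<le> y" "y \<le> 5 * u / 2" for y
  proof -
    have "a * y \<le> a * (5 * u / 2)" "b * (- u / 2) \<le> b * y"
      using pos that by (intro mult_left_mono; simp)+
    then show "1 - a * y > 0" "1 + b * y > 0"
      using au eps by auto
  qed
  have u3: "25 / 12 * u ^ 3 \<le> s * c"
  proof -
    have "25 / 12 * u ^ 3 = 25 * u\<^sup>2 * (m0 * u) / (12 * m0)"
      using m0_pos by (simp add: field_simps power2_eq_square power3_eq_cube)
    also have "\<dots> \<le> 25 * u\<^sup>2 * (\<epsilon> * s) / (12 * m0)"
      using m0_u m0_pos by (intro divide_right_mono mult_left_mono) (auto simp: s_def)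
    finally show ?thesis
      by (simp add: c_def mult_ac)
  qed
  have diff: "a - b = (\<theta>0' - \<theta>0) / s"
    by (simp add: a_def b_def diff_divide_distrib)
  have c_bound: "\<bar>a - b\<bar> * (25 / 12 * u ^ 3) \<le> \<bar>\<theta>0' - \<theta>0\<bar> * c"
    using mult_left_mono [OF u3, of "\<bar>a - b\<bar>"] s by (simp add: diff)
  have quad: "u * (u + x) - (u + x)\<^sup>2 / 2 = (u\<^sup>2 - x\<^sup>2) / 2" for x
    by (simp add: field_simps power2_eq_square)
  \<comment> \<open>The interval is closed so that the estimate also serves at its ends in
    \<open>outer\<close>.\<close>
  have log_le: "log_lr a b u y \<le> cubic_lr a b u y + 1 / 12 * (u\<^sup>2 * \<epsilon>\<^sup>2 / (1 - \<epsilon>))"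
    if "- u / 2 \<le> y" "y \<le> 5 * u / 2" for y
    using rem_lr_le [OF pos le u_pos Mu1(1) dom [OF that]]
    by (simp add: rem_lr_def Mu Mu4)
  have log_ge: "log_lr a b u y \<ge> cubic_lr a b u y - 297 / 32 * (u\<^sup>2 * \<epsilon>\<^sup>2 / (2 - 5 * \<epsilon>))"
    if "- u / 2 \<le> y" "y \<le> 5 * u / 2" for y
    using rem_lr_ge [OF pos le u_pos Mu1(2) that] by (simp add: rem_lr_def Mu Mu4)

  have inner: "LR \<theta>0 n k x \<le> exp ((u\<^sup>2 - x\<^sup>2) / 2 + \<bar>\<theta>0' - \<theta>0\<bar> * c
          + 1 / 12 * (u\<^sup>2 * \<epsilon>\<^sup>2 / (1 - \<epsilon>)))
      \<and> LR \<theta>0 n k x \<ge> exp ((u\<^sup>2 - x\<^sup>2) / 2 - \<bar>\<theta>0' - \<theta>0\<bar> * c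
          - 297 / 32 * (u\<^sup>2 * \<epsilon>\<^sup>2 / (2 - 5 * \<epsilon>)))"
    if "- (3 / 2) * u < x \<and> x < 3 / 2 * u" for x
  proof -
    have y: "- u / 2 \<le> u + x" "u + x \<le> 5 * u / 2"
      using that by auto
    have "\<bar>(a - b) * (u * (u + x)\<^sup>2 / 2 - (u + x) ^ 3 / 3)\<bar> \<le> \<bar>a - b\<bar> * (25 / 12 * u ^ 3)"
      unfolding abs_mult by (intro mult_left_mono cubic_term_abs_le u_pos y) simp
    with c_bound have "\<bar>cubic_lr a b u (u + x) - (u\<^sup>2 - x\<^sup>2) / 2\<bar> \<le> \<bar>\<theta>0' - \<theta>0\<bar> * c"
      unfolding cubic_lr_def quad by simp
    then show ?thesis
      using log_le [OF y] log_ge [OF y] unfolding LR_eq [OF dom [OF y]] exp_le_cancel_iff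
      by linarith
  qed

  have outer: "LR \<theta>0 n k x \<le> exp (- u\<^sup>2 / 2)"
    if cond: "\<theta>0 \<le> \<theta>0' \<or> 250 * (\<theta>0 - \<theta>0') * \<epsilon> \<le> 12 * m0"
      and x: "\<not> (- (3 / 2) * u < x \<and> x < 3 / 2 * u)"
      and th: "0 \<le> theta \<theta>0 n k x" "theta \<theta>0 n k x \<le> 1" for x
  proof -
    define y where "y = u + x"
    have ratios: "theta \<theta>0 n k x / \<theta>0 = 1 - a * y"
        "(1 - theta \<theta>0 n k x) / (1 - \<theta>0) = 1 + b * y"
      using theta_ratios [OF theta0 n u, of x] by (simp_all add: a_def b_def s_def theta0' y_def)
    have nonneg: "1 - a * y \<ge> 0" "1 + b * y \<ge> 0"
      using th theta0 by (simp_all flip: ratios)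
    \<comment> \<open>Positive exponents exclude \<open>0 ^ 0 = 1\<close> when \<open>theta\<close>
      is 0 or 1, so the likelihood ratio is 0 there.\<close>
    have kpos: "k > 0" "n - k > 0"
    proof -
      have "1 / a - u > 0" "1 / b + u > 0"
        using pos au(1) eps u_pos by (simp_all add: pos_less_divide_eq mult.commute add_pos_pos)
      then have "real k > 0" "real (n - k) > 0"
        using pos
        unfolding exponents_eq [OF theta0 n k u, folded s_def, folded theta0', folded a_def b_def]
        by simp_all
      then show "k > 0" "n - k > 0"
        by simp_all
    qed
    \<comment> \<open>The quotient \<open>\<epsilon>\<^sup>2 / (1 - \<epsilon>)\<close> increases
      with \<open>\<epsilon>\<close> and equals \<open>4 / 15\<close> at
      \<open>2 / 5\<close>.\<close>
    have rem_small: "1 / 12 * (u\<^sup>2 * \<epsilon>\<^sup>2 / (1 - \<epsilon>)) \<le> u\<^sup>2 / 45"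
    proof -
      have "\<epsilon>\<^sup>2 / (1 - \<epsilon>) \<le> (2 / 5)\<^sup>2 / (1 - 2 / 5)"
        using eps by (intro frac_le power_mono) auto
      then have "\<epsilon>\<^sup>2 / (1 - \<epsilon>) \<le> 4 / 15"
        by (simp add: power2_eq_square)
      then have "u\<^sup>2 * (\<epsilon>\<^sup>2 / (1 - \<epsilon>)) \<le> u\<^sup>2 * (4 / 15)"
        by (rule mult_left_mono) simp
      then have "u\<^sup>2 * \<epsilon>\<^sup>2 / (1 - \<epsilon>) \<le> 4 / 15 * u\<^sup>2"
        by (simp add: mult.commute)
      then show ?thesis
        by linarith
    qed
    \<comment> \<open>The quadratic part is \<open>- 5 / 8 * u\<^sup>2\<close>, leaving a margin of
      \<open>u\<^sup>2 / 8\<close>. The cubic term and the remainder use at most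
      \<open>1 / 15 + 1 / 45 = 4 / 45\<close> of \<open>u\<^sup>2\<close>.\<close>
    have left: "log_lr a b u (- u / 2) \<le> - u\<^sup>2 / 2"
    proof -
      have "(a - b) * (u ^ 3 / 6) \<le> a * (u ^ 3 / 6)"
        using pos u_pos by (intro mult_right_mono) auto
      also have "\<dots> = a * u * (u\<^sup>2 / 6)"
        by (simp add: power2_eq_square power3_eq_cube)
      also have "\<dots> \<le> 2 / 5 * (u\<^sup>2 / 6)"
        using au eps by (intro mult_right_mono) auto
      finally have "(a - b) * (u ^ 3 / 6) \<le> u\<^sup>2 / 15"
        by simp
      moreover have "cubic_lr a b u (- u / 2) = - (5 / 8 * u\<^sup>2) + (a - b) * (u ^ 3 / 6)"
        by (simp add: cubic_lr_def field_simps power2_eq_square power3_eq_cube)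
      moreover have "log_lr a b u (- u / 2) \<le> cubic_lr a b u (- u / 2) + u\<^sup>2 / 45"
        using u_pos by (intro order_trans [OF log_le] add_left_mono rem_small) auto
      ultimately show ?thesis
        using zero_le_power2 [of u] by linarith
    qed
    \<comment> \<open>The margin is again \<open>u\<^sup>2 / 8\<close>, against
      \<open>1 / 10 + 1 / 45 = 11 / 90\<close>. The cubic term is harmful only for
      \<open>\<theta>0 > \<theta>0'\<close>, and then the condition with 250 says that
      \<open>\<bar>\<theta>0' - \<theta>0\<bar> * c \<le> u\<^sup>2 / 10\<close>.\<close>
    have right: "log_lr a b u (5 * u / 2) \<le> - u\<^sup>2 / 2"
    proof -
      have "(b - a) * (25 / 12 * u ^ 3) \<le> u\<^sup>2 / 10"
      proof (cases "\<theta>0 \<le> \<theta>0'")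
        case True
        then have "b - a \<le> 0"
          using s by (simp add: a_def b_def divide_right_mono)
        then have "(b - a) * (25 / 12 * u ^ 3) \<le> 0"
          using u_pos by (intro mult_nonpos_nonneg) auto
        then show ?thesis
          using zero_le_power2 [of u] by linarith
      next
        case False
        then have "\<bar>\<theta>0' - \<theta>0\<bar> * c = 250 * (\<theta>0 - \<theta>0') * \<epsilon> / (12 * m0) * (u\<^sup>2 / 10)"
          using m0_pos by (simp add: c_def field_simps)
        also have "\<dots> \<le> 1 * (u\<^sup>2 / 10)"
          using False cond m0_pos by (intro mult_right_mono) auto
        finally have "\<bar>a - b\<bar> * (25 / 12 * u ^ 3) \<le> u\<^sup>2 / 10"
          using c_bound by simp
        moreover have "(b - a) * (25 / 12 * u ^ 3) \<le> \<bar>a - b\<bar> * (25 / 12 * u ^ 3)"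
          using u_pos by (intro mult_right_mono) auto
        ultimately show ?thesis
          by linarith
      qed
      moreover have "cubic_lr a b u (5 * u / 2) = - (5 / 8 * u\<^sup>2) + (b - a) * (25 / 12 * u ^ 3)"
        by (simp add: cubic_lr_def field_simps power2_eq_square power3_eq_cube)
      moreover have "log_lr a b u (5 * u / 2) \<le> cubic_lr a b u (5 * u / 2) + u\<^sup>2 / 45"
        using u_pos by (intro order_trans [OF log_le] add_left_mono rem_small) auto
      ultimately show ?thesis
        using zero_le_power2 [of u] by linarith
    qed
    show ?thesis
    proof (cases "1 - a * y = 0 \<or> 1 + b * y = 0")
      case True
      then have "LR \<theta>0 n k x = 0"
        using kpos by (auto simp: LR_def ratios)
      then show ?thesis
        by simp
    next
      case False
      then have y: "1 - a * y > 0" "1 + b * y > 0"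
        using nonneg by auto
      have "log_lr a b u y \<le> - u\<^sup>2 / 2"
      proof (cases "y \<le> - u / 2")
        case True
        then show ?thesis
          using log_lr_mono [of a b y "- u / 2" u] left pos y dom [of "- u / 2"] u_pos by simp
      next
        case False
        then have "5 * u / 2 \<le> y"
          using x by (auto simp: y_def)
        then show ?thesis
          using log_lr_antimono [of a b "5 * u / 2" y u] right pos y dom [of "5 * u / 2"] u_pos
          by simp
      qed
      then show ?thesis
        using LR_eq [of x] y by (simp add: y_def)
    qed
  qed

  show ?thesis
    using inner outer unfolding c_def by blast
qed

end
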